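(* Let $M\subset\mathbb{R}^D$ be a submanifold with reach $\tau_M>0$ that has a bottleneck $(q_1,q_2)\in M^2$, and let $\mathbb{X}\subset M$. If there exist $x,y\in\mathbb{X}$ with $\|q_1-x\|<\tau_M$ and $\|q_2-y\|<\tau_M$, then $$0\le\frac{1}{\tau_M}-\frac{1}{\hat\tau(\mathbb{X})}\le\frac{1}{\tau_M}-\frac{1}{\hat\tau(\{x,y\})}\le\frac{4}{\tau_M^2}\max\{d_M(q_1,x),d_M(q_2,y)\}.$$
   Context: $D\ge 2$ and $\mathbb{R}^D$ carries the Euclidean norm $\|\cdot\|$; $\mathcal{B}(x,r)$ is the closed ball of center $x$ and radius $r$. Submanifolds of $\mathbb{R}^D$ are embedded, compact, connected, without boundary, of dimension $1\le d<D$. $T_pM\subset\mathbb{R}^D$ is the tangent space at $p$ (a $d$-dimensional linear subspace) and $d_M$ is the geodesic distance on $M$ (infimum of Euclidean lengths of paths in $M$). For closed $A\subset\mathbb{R}^D$, $d(z,A)=\inf_{p\in A}\|p-z\|$, the medial axis is $Med(A)=\{z : \exists\, p\ne q\in A,\ \|p-z\|=\|q-z\|=d(z,A)\}$, and the reach is $\tau_A=\inf_{z\in Med(A)}d(z,A)$. A bottleneck of $M$ is a pair $(q_1,q_2)\in M^2$ such that there is $z_0\in Med(M)$ with $q_1,q_2\in\mathcal{B}(z_0,\tau_M)$ and $\|q_1-q_2\|=2\tau_M$. For $\mathbb{X}\subset M$, $$\hat\tau(\mathbb{X})=\inf_{x\ne y\in\mathbb{X}}\frac{\|y-x\|^2}{2\,d(y-x,T_xM)},$$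 with conventions $a/0=+\infty$ for $a>0$, $\inf\emptyset=+\infty$, $1/\infty=0$. *)

theory Defs
  imports "HOL-Analysis.Analysis"
begin

definition C1_map_on :: "'a::euclidean_space set \<Rightarrow> ('a \<Rightarrow> 'a) \<Rightarrow> bool" where
  "C1_map_on U f \<longleftrightarrow>
     (\<exists>f' :: 'a \<Rightarrow> 'a \<Rightarrow>\<^sub>L 'a.
        (\<forall>x\<in>U. (f has_derivative blinfun_apply (f' x)) (at x)) \<and> continuous_on U f')"

text \<open>Embedded submanifolds are given by slice charts: near each of its points, \<open>M\<close> is mapped
  onto a piece of a \<open>d\<close>-dimensional linear subspace by a \<open>C\<^sup>1\<close> diffeomorphism between open sets of
  the ambient space, so there is no boundary. \<open>C\<^sup>1\<close> is the least regularity for which tangent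
  spaces make sense; smoother submanifolds are included.\<close>

definition submanifold :: "nat \<Rightarrow> 'a::euclidean_space set \<Rightarrow> bool" where
  "submanifold d M \<longleftrightarrow>
     1 \<le> d \<and> d < DIM('a) \<and> M \<noteq> {} \<and> compact M \<and> connected M \<and>
     (\<forall>p\<in>M. \<exists>U V S \<phi> \<psi>.
        open U \<and> p \<in> U \<and> open V \<and> subspace S \<and> dim S = d \<and>
        homeomorphism U V \<phi> \<psi> \<and> C1_map_on U \<phi> \<and> C1_map_on V \<psi> \<and>
        \<phi> ` (M \<inter> U) = S \<inter> V)"

text \<open>Velocities at \<open>p\<close> of \<open>C\<^sup>1\<close> curves in \<open>M\<close>.\<close>

definition tangent_space :: "'a::euclidean_space set \<Rightarrow> 'a \<Rightarrow> 'a set" where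
  "tangent_space M p =
     {v. \<exists>\<gamma> \<epsilon>. 0 < \<epsilon> \<and> \<gamma> C1_differentiable_on {-\<epsilon><..<\<epsilon>} \<and> \<gamma> ` {-\<epsilon><..<\<epsilon>} \<subseteq> M \<and>
               \<gamma> 0 = p \<and> (\<gamma> has_vector_derivative v) (at 0)}"

text \<open>Supremum of the lengths of inscribed polygons; the list \<open>ts\<close> is a subdivision of \<open>[0,1]\<close>.\<close>

definition curve_length :: "(real \<Rightarrow> 'a::euclidean_space) \<Rightarrow> ereal" where
  "curve_length \<gamma> =
     (SUP ts\<in>{ts. sorted ts \<and> set ts \<subseteq> {0..1}}.
        ereal (\<Sum>i<length ts - 1. norm (\<gamma> (ts ! Suc i) - \<gamma> (ts ! i))))"

definition geodesic_dist :: "'a::euclidean_space set \<Rightarrow> 'a \<Rightarrow> 'a \<Rightarrow> ereal" where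
  "geodesic_dist M p q =
     (INF \<gamma>\<in>{\<gamma>. path \<gamma> \<and> path_image \<gamma> \<subseteq> M \<and> pathstart \<gamma> = p \<and> pathfinish \<gamma> = q}.
        curve_length \<gamma>)"

definition medial_axis :: "'a::euclidean_space set \<Rightarrow> 'a set" where
  "medial_axis A =
     {z. \<exists>p\<in>A. \<exists>q\<in>A. p \<noteq> q \<and> norm (p - z) = infdist z A \<and> norm (q - z) = infdist z A}"

definition reach :: "'a::euclidean_space set \<Rightarrow> ereal" where
  "reach A = (INF z\<in>medial_axis A. ereal (infdist z A))"

definition bottleneck :: "'a::euclidean_space set \<Rightarrow> 'a \<Rightarrow> 'a \<Rightarrow> bool" where
  "bottleneck M q1 q2 \<longleftrightarrow>
     q1 \<in> M \<and> q2 \<in> M \<and>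
     (\<exists>z0\<in>medial_axis M. ereal (norm (q1 - z0)) \<le> reach M \<and> ereal (norm (q2 - z0)) \<le> reach M) \<and>
     ereal (norm (q1 - q2)) = 2 * reach M"

text \<open>In \<^typ>\<open>ereal\<close>, \<open>a / 0 = \<infinity>\<close> for \<open>a > 0\<close>, \<open>1 / \<infinity> = 0\<close>, and the infimum over the
  empty set is \<open>\<infinity>\<close>.\<close>

definition reach_estimator :: "'a::euclidean_space set \<Rightarrow> 'a set \<Rightarrow> ereal" where
  "reach_estimator M X =
     (INF (x, y)\<in>{(x, y). x \<in> X \<and> y \<in> X \<and> x \<noteq> y}.
        ereal ((norm (y - x))\<^sup>2) / ereal (2 * infdist (y - x) (tangent_space M x)))"

end

theory Submission
  imports Defs
begin

text \<open>
  Let \<open>t\<close> be the reach of \<open>M\<close>. All estimates come from the following fact: if \<open>\<nu>\<close> is a unit normal vector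
  at \<open>x \<in> M\<close>, the open ball of radius \<open>t\<close> around \<open>x + t *\<^sub>R \<nu>\<close> contains no point of \<open>M\<close>
  (\<open>normal_ball_empty\<close>), that is, \<open>2 * t * (\<nu> \<bullet> (b - x)) \<le> (norm (b - x))\<^sup>2\<close> for all \<open>b \<in> M\<close>. Its proof
  first treats the direction from a nearest point \<open>p\<close> of some \<open>z\<close> to \<open>z\<close>: within the reach the
  nearest-point map is continuous, and Brouwer's fixed point theorem shows that \<open>z\<close> can be pushed
  away from \<open>p\<close> up to distance \<open>t\<close> while \<open>p\<close> stays its nearest point (\<open>nearest_point_beyond\<close>). An
  arbitrary normal vector is a limit of such directions.

  Applied to the normal part of \<open>y - x\<close>, the inequality says that no quotient in the definition of the
  estimator is smaller than \<open>t\<close>. So the estimator never underestimates the reach, and it can only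
  decrease when points are added. This gives the first two inequalities.

  For the last one, the quotient at \<open>(x, y)\<close> is compared with the one at the bottleneck, which is
  exactly \<open>t\<close> because \<open>q2 - q1\<close> is normal to \<open>M\<close> at both ends. Three things change when \<open>(q1, q2)\<close> is
  replaced by \<open>(x, y)\<close>. The length of the chord changes only to second order, by the empty balls at
  \<open>q1\<close> and \<open>q2\<close>. The chord itself moves by at most \<open>2 * m\<close>, where \<open>m\<close> is the larger geodesic distance.
  And the tangent space at \<open>q1\<close> is replaced by the one at \<open>x\<close>: by \<open>normal_tilt_geodesic\<close>, a unit normal
  vector at \<open>q1\<close> has a projection of norm at most \<open>5 / 2 * m / t\<close> to the tangent space at \<open>x\<close>. That
  estimate is first proved for points that are sufficiently close, where three empty balls suffice, and then
  summed along a path. The tangential part of the chord is thus linear in \<open>m\<close>, and its influence on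
  the distance to the tangent space is quadratic in \<open>m\<close>, which is less than the linear term allowed
  if \<open>4 * m \<le> t\<close>. For larger \<open>m\<close> the claimed bound exceeds \<open>1 / t\<close> and is trivial.
\<close>

section \<open>Orthogonal decompositions\<close>

lemma norm_diff_scaleR_sq:
  fixes u v :: "'a::real_inner"
  shows "(norm (c *\<^sub>R u - v))\<^sup>2 = c\<^sup>2 * (norm u)\<^sup>2 - 2 * c * (u \<bullet> v) + (norm v)\<^sup>2"
  unfolding power2_norm_eq_inner
  by (simp add: inner_diff_left inner_diff_right inner_commute power2_eq_square)

lemma orthogonal_decomposition:
  fixes v :: "'a::euclidean_space"
  assumes "subspace T"
  obtains a c where "a \<in> T" "\<And>w. w \<in> T \<Longrightarrow> c \<bullet> w = 0" "v = a + c" "norm c \<le> norm v"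
proof -
  obtain a c where ac: "a \<in> span T" "\<And>w. w \<in> span T \<Longrightarrow> orthogonal c w" "v = a + c"
    using orthogonal_subspace_decomp_exists[of T v] by blast
  have T: "span T = T" using assms by (simp add: span_eq_iff)
  have c: "c \<bullet> w = 0" if "w \<in> T" for w using ac(2) that T by (simp add: orthogonal_def)
  have "(norm v)\<^sup>2 = (norm a)\<^sup>2 + (norm c)\<^sup>2"
    using c[of a] ac(1) norm_add_Pythagorean[of a c] T unfolding ac(3)
    by (simp add: orthogonal_def inner_commute)
  then have "(norm c)\<^sup>2 \<le> (norm v)\<^sup>2" using zero_le_power2[of "norm a"] by linarith
  then have "norm c \<le> norm v" by (rule power2_le_imp_le) simp
  then show thesis using that[OF ac(1)[unfolded T] c ac(3)] by blast
qed

text \<open>The bound on \<open>v \<bullet> w\<close> says that the orthogonal projection of \<open>v\<close> to \<open>T\<close> has norm at most \<open>k\<close>;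
  what is left of \<open>v\<close> by Pythagoras is its distance to \<open>T\<close>.\<close>

lemma infdist_ge_of_tangential_bound:
  fixes v :: "'a::euclidean_space"
  assumes T: "subspace T" and k: "\<And>w. w \<in> T \<Longrightarrow> v \<bullet> w \<le> k * norm w"
  shows "(norm v)\<^sup>2 - k\<^sup>2 \<le> (infdist v T)\<^sup>2"
proof -
  obtain w where w: "w \<in> T" "infdist v T = dist v w"
    using infdist_attains_inf[OF closed_subspace[OF T]] T subspace_0 by blast
  have "(norm (v - w))\<^sup>2 = (norm v)\<^sup>2 - 2 * (v \<bullet> w) + (norm w)\<^sup>2"
    using norm_diff_scaleR_sq[of 1 v w] by simp
  moreover have "0 \<le> (norm w - k)\<^sup>2" by simp
  then have "2 * (k * norm w) \<le> (norm w)\<^sup>2 + k\<^sup>2" by (simp add: power2_diff mult_ac)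
  ultimately show ?thesis using k[OF w(1)] w(2) by (simp add: dist_norm)
qed

section \<open>Nearest points within the reach\<close>

lemma norm_closest_point:
  assumes "compact M" "M \<noteq> {}"
  shows "norm (closest_point M z - z) = infdist z M"
proof (rule antisym)
  obtain p where "p \<in> M" "infdist z M = dist z p"
    using infdist_attains_inf assms compact_imp_closed by blast
  then show "norm (closest_point M z - z) \<le> infdist z M"
    using closest_point_le[OF compact_imp_closed[OF assms(1)], of p z]
    by (simp add: dist_norm norm_minus_commute)
  show "infdist z M \<le> norm (closest_point M z - z)"
    using infdist_le[OF closest_point_in_set[OF compact_imp_closed[OF assms(1)] assms(2)], of z z]
    by (simp add: dist_norm norm_minus_commute)
qed

lemma nearest_point_unique:
  assumes "ereal t \<le> reach M" "infdist z M < t"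
    and "p \<in> M" "norm (p - z) = infdist z M" and "q \<in> M" "norm (q - z) = infdist z M"
  shows "p = q"
proof (rule ccontr)
  assume "p \<noteq> q"
  then have "z \<in> medial_axis M"
    unfolding medial_axis_def using assms by blast
  then have "reach M \<le> ereal (infdist z M)"
    unfolding reach_def by (rule INF_lower)
  then show False
    using assms(1,2) by (metis ereal_less_eq(3) not_less order_trans)
qed

text \<open>The graph of the nearest-point map is closed because it is cut out by a continuous equation: by
  uniqueness, any point of \<open>M\<close> that realizes the distance is the chosen one.\<close>

lemma continuous_on_closest_point_reach:
  assumes "compact M" "M \<noteq> {}" "ereal t \<le> reach M"
    and K: "compact K" "\<And>w. w \<in> K \<Longrightarrow> infdist w M < t"
  shows "continuous_on K (closest_point M)"
proof (rule continuous_from_closed_graph[OF \<open>compact M\<close>])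
  have inM: "closest_point M w \<in> M" for w
    using assms closest_point_in_set compact_imp_closed by blast
  then show "closest_point M \<in> K \<rightarrow> M" by blast
  have "(\<lambda>x. (x, closest_point M x)) ` K =
      (K \<times> M) \<inter> {p. norm (snd p - fst p) = infdist (fst p) M}" (is "?L = ?R")
  proof
    show "?L \<subseteq> ?R"
      using inM norm_closest_point[OF assms(1,2)] by auto
    show "?R \<subseteq> ?L"
    proof
      fix p assume "p \<in> ?R"
      then have "fst p \<in> K" "snd p = closest_point M (fst p)"
        using nearest_point_unique[OF assms(3) K(2)] inM norm_closest_point[OF assms(1,2)]
        by auto
      then show "p \<in> ?L" by (cases p) auto
    qed
  qed
  moreover have "closed ?R"
    by (intro closed_Int closed_Times closed_Collect_eq continuous_intros compact_imp_closed K assms)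
  ultimately show "closed ?L" by metis
qed

text \<open>Moving from \<open>z\<close> by a further \<open>e\<close> straight away from its nearest point \<open>p\<close> does not change the nearest
  point. A point \<open>w\<close> at distance \<open>e\<close> from \<open>z\<close> such that \<open>z\<close> lies between \<open>w\<close> and the nearest point of
  \<open>w\<close> is found by Brouwer's theorem. The nearest point of \<open>w\<close> is then nearest to \<open>z\<close> as well, hence
  equal to \<open>p\<close>, which determines \<open>w\<close>.\<close>

lemma nearest_point_beyond:
  fixes M :: "'a::euclidean_space set"
  assumes M: "compact M" "M \<noteq> {}" and t: "ereal t \<le> reach M"
    and z: "z \<notin> M" "infdist z M < t" and p: "p \<in> M" "norm (p - z) = infdist z M"
    and b: "b \<in> M" and e: "0 < e" "infdist z M + e < t"
  shows "norm (z - p) + e \<le> norm (z + (e / norm (z - p)) *\<^sub>R (z - p) - b)"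
proof -
  define \<pi> where "\<pi> = closest_point M"
  \<comment> \<open>The point at distance \<open>e\<close> from \<open>z\<close> opposite to the nearest point of \<open>w\<close>.\<close>
  define f where "f w = z + (e / norm (z - \<pi> w)) *\<^sub>R (z - \<pi> w)" for w
  have inM: "\<pi> w \<in> M" for w
    using M closest_point_in_set compact_imp_closed unfolding \<pi>_def by blast
  then have ne: "z - \<pi> w \<noteq> 0" for w using z by (metis eq_iff_diff_eq_0)
  have near: "infdist w M < t" if "w \<in> cball z e" for w
    using infdist_triangle[of w M z] that e by (simp add: dist_commute)
  have "continuous_on (cball z e) \<pi>"
    unfolding \<pi>_def by (rule continuous_on_closest_point_reach[OF M t compact_cball near])
  then have "continuous_on (cball z e) f"
    unfolding f_def using ne by (intro continuous_intros) auto
  moreover have fd: "norm (f w - z) = e" for w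
    using ne[of w] e by (simp add: f_def)
  then have "f \<in> cball z e \<rightarrow> cball z e"
    by (auto simp: dist_norm norm_minus_commute)
  ultimately obtain w where w: "w \<in> cball z e" "f w = w"
    using brouwer_ball[OF e(1)] by metis
  define r where "r = norm (z - \<pi> w)"
  have rpos: "r > 0" using ne by (simp add: r_def)
  have weq: "w = z + (e / r) *\<^sub>R (z - \<pi> w)"
    using w(2) unfolding f_def r_def by simp
  have "w - \<pi> w = (1 + e / r) *\<^sub>R (z - \<pi> w)"
    by (subst (1) weq) (simp add: algebra_simps)
  then have "norm (w - \<pi> w) = (1 + e / r) * r"
    using rpos e by (simp add: r_def)
  also have "\<dots> = r + e" using rpos by (simp add: distrib_right)
  finally have dw: "norm (w - \<pi> w) = r + e" .
  have wmin: "r + e \<le> norm (w - c)" if "c \<in> M" for c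
    using closest_point_le[OF compact_imp_closed[OF M(1)] that, of w] dw
    by (simp add: dist_norm \<pi>_def)
  have zmin: "r \<le> norm (z - c)" if "c \<in> M" for c
    using wmin[OF that] norm_triangle_ineq[of "w - z" "z - c"] fd[of w] w(2) by simp
  have "norm (\<pi> w - z) = infdist z M"
    using zmin[OF p(1)] p(2) infdist_le[OF inM[of w], of z]
    by (simp add: r_def dist_norm norm_minus_commute)
  then have "\<pi> w = p"
    using nearest_point_unique[OF t z(2) inM _ p] by blast
  then show ?thesis
    using wmin[OF b] weq r_def by simp
qed

text \<open>The open ball of radius \<open>t\<close> that touches \<open>M\<close> at \<open>p\<close> and has its centre on the ray from \<open>p\<close> through \<open>z\<close>
  contains no point of \<open>M\<close>: its concentric version of radius \<open>s < t\<close> is empty by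
  \<open>nearest_point_beyond\<close>. Expanding the square turns this into an inequality that is linear in
  \<open>z - p\<close>.\<close>

lemma empty_ball_of_nearest_point:
  fixes M :: "'a::euclidean_space set"
  assumes M: "compact M" "M \<noteq> {}" and t: "ereal t \<le> reach M"
    and z: "z \<notin> M" "infdist z M < t" and p: "p \<in> M" "norm (p - z) = infdist z M"
    and b: "b \<in> M"
  shows "2 * t * ((z - p) \<bullet> (b - p)) \<le> norm (z - p) * (norm (b - p))\<^sup>2"
proof -
  define r where "r = norm (z - p)"
  have rpos: "r > 0" using z p r_def by auto
  have rt: "r < t" using z p r_def by (simp add: norm_minus_commute)
  have "2 * s * ((z - p) \<bullet> (b - p)) \<le> r * (norm (b - p))\<^sup>2" if s: "r < s" "s < t" for s
  proof -
    have "norm (z - p) + (s - r) \<le> norm (z + ((s - r) / norm (z - p)) *\<^sub>R (z - p) - b)"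
      using nearest_point_beyond[OF M t z p b, of "s - r"] s p
      by (simp add: r_def norm_minus_commute)
    also have "z + ((s - r) / norm (z - p)) *\<^sub>R (z - p) - b = (s / r) *\<^sub>R (z - p) - (b - p)"
      using rpos by (simp add: r_def[symmetric] diff_divide_distrib algebra_simps)
    finally have "s \<le> norm ((s / r) *\<^sub>R (z - p) - (b - p))" by (simp add: r_def)
    then have "s\<^sup>2 \<le> (norm ((s / r) *\<^sub>R (z - p) - (b - p)))\<^sup>2"
      using rpos s by (intro power_mono) auto
    also have "\<dots> = s\<^sup>2 - 2 * (s / r) * ((z - p) \<bullet> (b - p)) + (norm (b - p))\<^sup>2"
      unfolding norm_diff_scaleR_sq using rpos
      by (simp add: r_def[symmetric] power_divide)
    finally show ?thesis using rpos by (simp add: field_simps)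
  qed
  then have "eventually (\<lambda>s. 2 * s * ((z - p) \<bullet> (b - p)) \<le> r * (norm (b - p))\<^sup>2) (at_left t)"
    using rt by (auto simp: eventually_at_left)
  moreover have "((\<lambda>s. 2 * s * ((z - p) \<bullet> (b - p))) \<longlongrightarrow> 2 * t * ((z - p) \<bullet> (b - p))) (at_left t)"
    by (intro tendsto_intros)
  ultimately show ?thesis
    unfolding r_def by (intro tendsto_upperbound) auto
qed

section \<open>Charts and tangent spaces\<close>

locale slice_chart =
  fixes M U V S :: "'a::euclidean_space set" and \<phi> \<psi> :: "'a \<Rightarrow> 'a"
    and \<phi>' \<psi>' :: "'a \<Rightarrow> 'a \<Rightarrow>\<^sub>L 'a"
  assumes open_U: "open U" and open_V: "open V" and subspace_S: "subspace S"
    and homeo: "homeomorphism U V \<phi> \<psi>"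
    and deriv_phi: "\<And>x. x \<in> U \<Longrightarrow> (\<phi> has_derivative blinfun_apply (\<phi>' x)) (at x)"
    and cont_phi': "continuous_on U \<phi>'"
    and deriv_psi: "\<And>x. x \<in> V \<Longrightarrow> (\<psi> has_derivative blinfun_apply (\<psi>' x)) (at x)"
    and cont_psi': "continuous_on V \<psi>'"
    and image_M: "\<phi> ` (M \<inter> U) = S \<inter> V"
begin

lemma phi_in_V: "x \<in> U \<Longrightarrow> \<phi> x \<in> V"
  and psi_in_U: "s \<in> V \<Longrightarrow> \<psi> s \<in> U"
  and psi_phi: "x \<in> U \<Longrightarrow> \<psi> (\<phi> x) = x"
  and phi_psi: "s \<in> V \<Longrightarrow> \<phi> (\<psi> s) = s"
  using homeo unfolding homeomorphism_def by auto

lemma phi_in_S: "p \<in> M \<Longrightarrow> p \<in> U \<Longrightarrow> \<phi> p \<in> S"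
  using image_M by blast

lemma psi_in_M:
  assumes "s \<in> S" "s \<in> V" shows "\<psi> s \<in> M"
proof -
  obtain p where "p \<in> M \<inter> U" "s = \<phi> p" using image_M assms by blast
  then show ?thesis using psi_phi by simp
qed

lemma deriv_psi_phi:
  assumes "x \<in> U" shows "\<psi>' (\<phi> x) (\<phi>' x v) = v"
proof -
  have "((\<lambda>y. \<psi> (\<phi> y)) has_derivative (\<lambda>v. \<psi>' (\<phi> x) (\<phi>' x v))) (at x)"
    using has_derivative_compose[OF deriv_phi deriv_psi] assms phi_in_V by blast
  moreover have "((\<lambda>y. \<psi> (\<phi> y)) has_derivative (\<lambda>v. v)) (at x)"
    by (rule has_derivative_transform_within_open[OF has_derivative_ident open_U assms])
      (simp add: psi_phi)
  ultimately show ?thesis by (metis has_derivative_unique)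
qed

lemma deriv_phi_psi:
  assumes "x \<in> U" shows "\<phi>' x (\<psi>' (\<phi> x) v) = v"
proof -
  have "(\<phi> has_derivative \<phi>' x) (at (\<psi> (\<phi> x)))"
    using deriv_phi assms psi_phi by simp
  then have "((\<lambda>s. \<phi> (\<psi> s)) has_derivative (\<lambda>v. \<phi>' x (\<psi>' (\<phi> x) v))) (at (\<phi> x))"
    using has_derivative_compose[OF deriv_psi[OF phi_in_V[OF assms]]] by blast
  moreover have "((\<lambda>s. \<phi> (\<psi> s)) has_derivative (\<lambda>v. v)) (at (\<phi> x))"
    by (rule has_derivative_transform_within_open[OF has_derivative_ident open_V phi_in_V[OF assms]])
      (simp add: phi_psi)
  ultimately show ?thesis by (metis has_derivative_unique)
qed

text \<open>\<open>\<subseteq>\<close>: difference quotients of the coordinates of a curve in \<open>M\<close> stay in the closed set \<open>S\<close>.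
  \<open>\<supseteq>\<close>: the inverse chart turns straight lines in \<open>S\<close> into curves in \<open>M\<close>.\<close>

lemma tangent_space_eq:
  assumes p: "p \<in> M" "p \<in> U"
  shows "tangent_space M p = \<psi>' (\<phi> p) ` S"
proof
  show "tangent_space M p \<subseteq> \<psi>' (\<phi> p) ` S"
  proof
    fix v assume "v \<in> tangent_space M p"
    then obtain \<gamma> \<epsilon> where e: "0 < \<epsilon>" and im: "\<gamma> ` {-\<epsilon><..<\<epsilon>} \<subseteq> M" and g0: "\<gamma> 0 = p"
      and dg: "(\<gamma> has_vector_derivative v) (at 0)"
      unfolding tangent_space_def by blast
    have "(\<phi> has_derivative \<phi>' p) (at (\<gamma> 0))" using deriv_phi p g0 by simp
    from has_derivative_compose[OF dg[unfolded has_vector_derivative_def] this]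
    have "((\<lambda>h. \<phi> (\<gamma> h)) has_vector_derivative \<phi>' p v) (at 0)"
      by (simp add: has_vector_derivative_def blinfun.scaleR_right)
    then have "((\<lambda>h. norm (\<phi> (\<gamma> h) - \<phi> p - h *\<^sub>R \<phi>' p v) / norm h) \<longlongrightarrow> 0) (at 0)"
      using g0 by (simp add: has_vector_derivative_def has_derivative_at)
    moreover have "norm (\<phi> (\<gamma> h) - \<phi> p - h *\<^sub>R \<phi>' p v) / norm h =
        norm ((1 / h) *\<^sub>R (\<phi> (\<gamma> h) - \<phi> p) - \<phi>' p v)" if "h \<noteq> 0" for h
    proof -
      have "(1 / h) *\<^sub>R (\<phi> (\<gamma> h) - \<phi> p) - \<phi>' p v = (1 / h) *\<^sub>R (\<phi> (\<gamma> h) - \<phi> p - h *\<^sub>R \<phi>' p v)"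
        using that by (simp add: algebra_simps)
      then show ?thesis by simp
    qed
    then have "eventually (\<lambda>h. norm (\<phi> (\<gamma> h) - \<phi> p - h *\<^sub>R \<phi>' p v) / norm h =
        norm ((1 / h) *\<^sub>R (\<phi> (\<gamma> h) - \<phi> p) - \<phi>' p v)) (at 0)"
      by (simp add: eventually_at_filter)
    ultimately have "((\<lambda>h. norm ((1 / h) *\<^sub>R (\<phi> (\<gamma> h) - \<phi> p) - \<phi>' p v)) \<longlongrightarrow> 0) (at 0)"
      by (rule Lim_transform_eventually)
    then have lim: "((\<lambda>h. (1 / h) *\<^sub>R (\<phi> (\<gamma> h) - \<phi> p)) \<longlongrightarrow> \<phi>' p v) (at 0)"
      by (simp add: tendsto_norm_zero_iff LIM_zero_iff)
    have "isCont \<gamma> 0" using dg has_vector_derivative_continuous by blast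
    then have "eventually (\<lambda>h. \<gamma> h \<in> U) (at 0)"
      using open_U p g0 by (metis continuous_at topological_tendstoD isCont_def)
    moreover have "eventually (\<lambda>h. h \<in> {-\<epsilon><..<\<epsilon>}) (at 0)"
      using e by (intro eventually_at_in_open') auto
    ultimately have "eventually (\<lambda>h. (1 / h) *\<^sub>R (\<phi> (\<gamma> h) - \<phi> p) \<in> S) (at 0)"
    proof eventually_elim
      case (elim h)
      then have "\<phi> (\<gamma> h) \<in> S" using im phi_in_S by blast
      then show ?case
        using phi_in_S[OF p] subspace_S by (simp add: subspace_diff subspace_scale)
    qed
    then have "\<phi>' p v \<in> S"
      using Lim_in_closed_set[OF closed_subspace[OF subspace_S] _ _ lim] by simp
    then show "v \<in> \<psi>' (\<phi> p) ` S"
      using deriv_psi_phi[OF p(2), of v] by (metis image_eqI)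
  qed
  show "\<psi>' (\<phi> p) ` S \<subseteq> tangent_space M p"
  proof
    fix v assume "v \<in> \<psi>' (\<phi> p) ` S"
    then obtain \<sigma> where s: "\<sigma> \<in> S" "v = \<psi>' (\<phi> p) \<sigma>" by blast
    define l where "l h = \<phi> p + h *\<^sub>R \<sigma>" for h :: real
    have "open (l -` V)"
      unfolding l_def by (intro open_vimage open_V continuous_intros)
    moreover have "0 \<in> l -` V" using phi_in_V p by (simp add: l_def)
    ultimately obtain \<epsilon> where e: "0 < \<epsilon>" "ball 0 \<epsilon> \<subseteq> l -` V"
      using open_contains_ball by blast
    then have lV: "l h \<in> V" if "h \<in> {-\<epsilon><..<\<epsilon>}" for h
      using that by (auto simp: subset_iff)
    have "(l has_vector_derivative \<sigma>) (at h)" for h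
      unfolding l_def by (auto intro!: derivative_eq_intros)
    then have D: "((\<lambda>h. \<psi> (l h)) has_vector_derivative \<psi>' (l h) \<sigma>) (at h)"
      if "h \<in> {-\<epsilon><..<\<epsilon>}" for h
      using has_derivative_compose[where f = l and f' = "\<lambda>h. h *\<^sub>R \<sigma>", OF _ deriv_psi[OF lV[OF that]]]
      by (simp add: has_vector_derivative_def blinfun.scaleR_right)
    have "continuous_on {-\<epsilon><..<\<epsilon>} (\<lambda>h. \<psi>' (l h))"
      by (rule continuous_on_compose2[OF cont_psi'])
        (auto simp: l_def intro!: continuous_intros lV[unfolded l_def])
    then have "(\<lambda>h. \<psi> (l h)) C1_differentiable_on {-\<epsilon><..<\<epsilon>}"
      unfolding C1_differentiable_on_def using D
      by (intro exI[of _ "\<lambda>h. \<psi>' (l h) \<sigma>"] conjI ballI) (auto intro!: continuous_intros)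
    moreover have "l h \<in> S" for h
      unfolding l_def using subspace_S phi_in_S[OF p] s by (simp add: subspace_add subspace_scale)
    then have "(\<lambda>h. \<psi> (l h)) ` {-\<epsilon><..<\<epsilon>} \<subseteq> M"
      using psi_in_M lV by blast
    moreover have "\<psi> (l 0) = p" using psi_phi p by (simp add: l_def)
    moreover have "((\<lambda>h. \<psi> (l h)) has_vector_derivative v) (at 0)"
      using D[of 0] e s by (simp add: l_def)
    ultimately show "v \<in> tangent_space M p"
      unfolding tangent_space_def using e(1) by blast
  qed
qed

lemma subspace_tangent_space:
  assumes "p \<in> M" "p \<in> U"
  shows "subspace (tangent_space M p)"
  unfolding tangent_space_eq[OF assms]
  by (intro linear_subspace_image subspace_S bounded_linear.linear blinfun.bounded_linear_right)

text \<open>\<open>M\<close> leaves \<open>p\<close> tangentially: \<open>b - p\<close> agrees to first order with the tangent vector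
  \<open>\<psi>' (\<phi> p) (\<phi> b - \<phi> p)\<close>, since the map \<open>b \<mapsto> b - \<psi>' (\<phi> p) (\<phi> b)\<close> has derivative \<open>0\<close> at \<open>p\<close>.\<close>

lemma normal_component_small:
  assumes p: "p \<in> M" "p \<in> U" and n: "\<And>w. w \<in> tangent_space M p \<Longrightarrow> \<nu> \<bullet> w = 0" and e: "0 < \<epsilon>"
  shows "\<exists>r>0. \<forall>b\<in>M. norm (b - p) < r \<longrightarrow> \<nu> \<bullet> (b - p) \<le> \<epsilon> * norm (b - p)"
proof -
  define g where "g b = \<nu> \<bullet> (b - \<psi>' (\<phi> p) (\<phi> b))" for b
  have "((\<lambda>b. \<psi>' (\<phi> p) (\<phi> b)) has_derivative (\<lambda>v. \<psi>' (\<phi> p) (\<phi>' p v))) (at p)"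
    using has_derivative_compose[OF deriv_phi[OF p(2)]
        bounded_linear_imp_has_derivative[OF blinfun.bounded_linear_right]] .
  then have "(g has_derivative (\<lambda>v. \<nu> \<bullet> (v - v))) (at p)"
    unfolding g_def deriv_psi_phi[OF p(2)] by (intro derivative_intros)
  then have "(g has_derivative (\<lambda>v. 0)) (at p)" by simp
  then obtain r0 where r0: "r0 > 0" "\<And>b. norm (b - p) < r0 \<Longrightarrow> \<bar>g b - g p\<bar> \<le> \<epsilon> * norm (b - p)"
    using e unfolding has_derivative_at_alt by fastforce
  obtain r1 where r1: "r1 > 0" "ball p r1 \<subseteq> U"
    using open_U p(2) open_contains_ball by blast
  have "\<nu> \<bullet> (b - p) \<le> \<epsilon> * norm (b - p)" if b: "b \<in> M" "norm (b - p) < min r0 r1" for b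
  proof -
    have "b \<in> U" using b r1 by (auto simp: dist_norm norm_minus_commute subset_iff)
    then have "\<phi> b - \<phi> p \<in> S" using phi_in_S b p subspace_S by (simp add: subspace_diff)
    then have "\<nu> \<bullet> \<psi>' (\<phi> p) (\<phi> b - \<phi> p) = 0"
      using n tangent_space_eq[OF p] by blast
    then have "g b - g p = \<nu> \<bullet> (b - p)"
      unfolding g_def by (simp add: inner_diff_right blinfun.diff_right)
    then show ?thesis using r0(2)[of b] b by simp
  qed
  then show ?thesis using r0 r1 by (intro exI[of _ "min r0 r1"]) auto
qed

text \<open>The step is taken along a straight line in the chart. Continuity of the derivatives of both chart
  maps makes the admissible step length uniform near \<open>p0\<close>.\<close>

lemma tangential_step_near:
  assumes p0: "p0 \<in> M" "p0 \<in> U" and e: "0 < \<epsilon>"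
  shows "\<exists>r>0. \<forall>p\<in>M. \<forall>w\<in>tangent_space M p. \<forall>h. norm (p - p0) < r \<longrightarrow> norm w = 1 \<longrightarrow> 0 < h \<longrightarrow> h < r
    \<longrightarrow> (\<exists>b\<in>M. norm (b - p - h *\<^sub>R w) \<le> \<epsilon> * h)"
proof -
  define K where "K = norm (\<phi>' p0) + 1"
  have K: "K > 0" unfolding K_def using norm_ge_zero[of "\<phi>' p0"] by linarith
  define e1 where "e1 = \<epsilon> / (2 * K)"
  have e1: "e1 > 0" using e K by (simp add: e1_def)
  have "isCont \<psi>' (\<phi> p0)"
    using cont_psi' open_V phi_in_V p0 by (simp add: continuous_on_eq_continuous_at)
  then have "eventually (\<lambda>s. dist (\<psi>' s) (\<psi>' (\<phi> p0)) < e1) (nhds (\<phi> p0))"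
    using e1 by (simp add: isCont_def tendsto_at_iff_tendsto_nhds tendstoD)
  moreover have "eventually (\<lambda>s. s \<in> V) (nhds (\<phi> p0))"
    using open_V phi_in_V p0 by (simp add: eventually_nhds_in_open)
  ultimately have "eventually (\<lambda>s. dist (\<psi>' s) (\<psi>' (\<phi> p0)) < e1 \<and> s \<in> V) (nhds (\<phi> p0))"
    by (rule eventually_conj)
  then obtain \<rho> where rho: "\<rho> > 0"
    "\<And>s. dist s (\<phi> p0) < \<rho> \<Longrightarrow> dist (\<psi>' s) (\<psi>' (\<phi> p0)) < e1 \<and> s \<in> V"
    unfolding eventually_nhds_metric by blast
  have "isCont \<phi>' p0" "isCont \<phi> p0"
    using cont_phi' open_U p0 has_derivative_continuous[OF deriv_phi]
    by (auto simp: continuous_on_eq_continuous_at)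
  then have "eventually (\<lambda>p. dist (\<phi>' p) (\<phi>' p0) < 1) (nhds p0)"
    "eventually (\<lambda>p. dist (\<phi> p) (\<phi> p0) < \<rho> / 2) (nhds p0)"
    "eventually (\<lambda>p. p \<in> U) (nhds p0)"
    using rho(1) p0 open_U
    by (auto simp: isCont_def tendsto_at_iff_tendsto_nhds eventually_nhds_in_open
        simp del: less_divide_eq_numeral1 intro!: tendstoD)
  then have "eventually (\<lambda>p. dist (\<phi>' p) (\<phi>' p0) < 1 \<and> dist (\<phi> p) (\<phi> p0) < \<rho> / 2 \<and> p \<in> U)
      (nhds p0)"
    by (intro eventually_conj)
  then obtain r0 where r0: "r0 > 0"
    "\<And>p. dist p p0 < r0 \<Longrightarrow> dist (\<phi>' p) (\<phi>' p0) < 1 \<and> dist (\<phi> p) (\<phi> p0) < \<rho> / 2 \<and> p \<in> U"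
    unfolding eventually_nhds_metric by blast
  define r where "r = min r0 (\<rho> / (2 * K))"
  have "\<exists>b\<in>M. norm (b - p - h *\<^sub>R w) \<le> \<epsilon> * h"
    if p: "p \<in> M" and w: "w \<in> tangent_space M p" "norm w = 1" and pr: "norm (p - p0) < r"
      and h: "0 < h" "h < r" for p w h
  proof -
    have p': "dist (\<phi>' p) (\<phi>' p0) < 1" "dist (\<phi> p) (\<phi> p0) < \<rho> / 2" "p \<in> U"
      using r0(2)[of p] pr by (auto simp: r_def dist_norm)
    obtain \<sigma> where s: "\<sigma> \<in> S" "w = \<psi>' (\<phi> p) \<sigma>"
      using w tangent_space_eq[OF p p'(3)] by blast
    define \<sigma>' where "\<sigma>' = \<phi>' p w"
    have "norm (\<phi>' p) \<le> K"
      using p'(1) norm_triangle_ineq2[of "\<phi>' p" "\<phi>' p0"] by (simp add: K_def dist_norm)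
    then have sK: "norm \<sigma>' \<le> K"
      using norm_blinfun[of "\<phi>' p" w] w by (simp add: \<sigma>'_def)
    have weq: "\<psi>' (\<phi> p) \<sigma>' = w" using deriv_psi_phi[OF p'(3)] by (simp add: \<sigma>'_def)
    have "\<sigma>' \<in> S" using s deriv_phi_psi[OF p'(3)] by (simp add: \<sigma>'_def)
    define b where "b = \<psi> (\<phi> p + h *\<^sub>R \<sigma>')"
    have hs: "h * norm \<sigma>' < \<rho> / 2"
    proof -
      have "h * norm \<sigma>' \<le> h * K" using h sK by (intro mult_left_mono) auto
      also have "\<dots> < \<rho> / (2 * K) * K" using h K by (intro mult_strict_right_mono) (auto simp: r_def)
      finally show ?thesis using K by simp
    qed
    have near: "dist (\<phi> p + (t * h) *\<^sub>R \<sigma>') (\<phi> p0) < \<rho>" if "t \<in> {0..1}" for t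
    proof -
      have "norm ((t * h) *\<^sub>R \<sigma>') \<le> h * norm \<sigma>'"
        using that h by (simp add: mult_left_le_one_le abs_mult mult_right_mono)
      then show ?thesis
        using norm_triangle_ineq[of "\<phi> p - \<phi> p0" "(t * h) *\<^sub>R \<sigma>'"] p'(2) hs
        by (simp add: dist_norm algebra_simps)
    qed
    have bM: "b \<in> M"
      unfolding b_def using near[of 1] rho(2) phi_in_S[OF p p'(3)] \<open>\<sigma>' \<in> S\<close> subspace_S
      by (intro psi_in_M) (auto simp: subspace_add subspace_scale)
    have "norm (\<psi> (\<phi> p + h *\<^sub>R \<sigma>') - \<psi> (\<phi> p) - \<psi>' (\<phi> p) ((\<phi> p + h *\<^sub>R \<sigma>') - \<phi> p))
        \<le> norm ((\<phi> p + h *\<^sub>R \<sigma>') - \<phi> p) * (2 * e1)"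
    proof (rule differentiable_bound_linearization[where S = "ball (\<phi> p0) \<rho>"
          and f' = "\<lambda>s. blinfun_apply (\<psi>' s)" and ?x0.0 = "\<phi> p"])
      show "\<phi> p + t *\<^sub>R (\<phi> p + h *\<^sub>R \<sigma>' - \<phi> p) \<in> ball (\<phi> p0) \<rho>" if "t \<in> {0..1}" for t
        using near[OF that] by (simp add: dist_commute)
      show "\<phi> p \<in> ball (\<phi> p0) \<rho>" using near[of 0] by (simp add: dist_commute)
      fix s assume "s \<in> ball (\<phi> p0) \<rho>"
      then have s: "dist (\<psi>' s) (\<psi>' (\<phi> p0)) < e1" "s \<in> V" using rho(2) by (auto simp: dist_commute)
      then show "(\<psi> has_derivative \<psi>' s) (at s within ball (\<phi> p0) \<rho>)"
        using deriv_psi has_derivative_at_withinI by blast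
      have "dist (\<psi>' (\<phi> p)) (\<psi>' (\<phi> p0)) < e1" using near[of 0] rho(2) by simp
      then have "norm (\<psi>' s - \<psi>' (\<phi> p)) \<le> 2 * e1"
        using s dist_triangle2[of "\<psi>' s" "\<psi>' (\<phi> p)" "\<psi>' (\<phi> p0)"] by (simp add: dist_norm)
      then show "onorm (blinfun_apply (\<psi>' s) - blinfun_apply (\<psi>' (\<phi> p))) \<le> 2 * e1"
        by (simp add: norm_blinfun.rep_eq minus_blinfun.rep_eq fun_diff_def)
    qed
    then have "norm (b - p - h *\<^sub>R w) \<le> h * norm \<sigma>' * (2 * e1)"
      using h by (simp add: b_def psi_phi p' blinfun.scaleR_right weq)
    also have "\<dots> \<le> h * K * (2 * e1)"
      using h sK e1 by (intro mult_right_mono mult_left_mono) auto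
    also have "\<dots> = \<epsilon> * h" using K by (simp add: e1_def)
    finally show ?thesis using bM by blast
  qed
  moreover have "r > 0" using r0 rho K by (simp add: r_def)
  ultimately show ?thesis by blast
qed

end

lemma submanifold_chart:
  assumes "submanifold d M" "p \<in> M"
  obtains U V S \<phi> \<psi> \<phi>' \<psi>' where "slice_chart M U V S \<phi> \<psi> \<phi>' \<psi>'" "p \<in> U"
proof -
  obtain U V S \<phi> \<psi> where c: "open U" "p \<in> U" "open V" "subspace S"
      "homeomorphism U V \<phi> \<psi>" "C1_map_on U \<phi>" "C1_map_on V \<psi>" "\<phi> ` (M \<inter> U) = S \<inter> V"
    using assms unfolding submanifold_def by metis
  obtain \<phi>' \<psi>' where
    "\<And>x. x \<in> U \<Longrightarrow> (\<phi> has_derivative blinfun_apply (\<phi>' x)) (at x)" "continuous_on U \<phi>'"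
    "\<And>x. x \<in> V \<Longrightarrow> (\<psi> has_derivative blinfun_apply (\<psi>' x)) (at x)" "continuous_on V \<psi>'"
    using c(6,7) unfolding C1_map_on_def by metis
  then have "slice_chart M U V S \<phi> \<psi> \<phi>' \<psi>'"
    unfolding slice_chart_def using c by auto
  then show thesis using that c(2) by blast
qed

text \<open>The absence of a boundary enters here: from every point, all tangent directions can be followed
  inside \<open>M\<close> for a length that does not depend on the point.\<close>

lemma uniform_tangential_step:
  assumes M: "submanifold d M" and e: "0 < \<epsilon>"
  obtains \<rho> where "0 < \<rho>"
    "\<And>p w h. p \<in> M \<Longrightarrow> w \<in> tangent_space M p \<Longrightarrow> norm w = 1 \<Longrightarrow> 0 < h \<Longrightarrow> h < \<rho>
      \<Longrightarrow> \<exists>b\<in>M. norm (b - p - h *\<^sub>R w) \<le> \<epsilon> * h"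
proof -
  have "\<exists>r>0. \<forall>p\<in>M. \<forall>w\<in>tangent_space M p. \<forall>h. norm (p - p0) < r \<longrightarrow> norm w = 1 \<longrightarrow> 0 < h \<longrightarrow> h < r
    \<longrightarrow> (\<exists>b\<in>M. norm (b - p - h *\<^sub>R w) \<le> \<epsilon> * h)" if "p0 \<in> M" for p0
    using submanifold_chart[OF M that] slice_chart.tangential_step_near that e by metis
  then obtain r where r: "\<And>p0. p0 \<in> M \<Longrightarrow> r p0 > 0"
    "\<And>p0 p w h. \<lbrakk>p0 \<in> M; p \<in> M; w \<in> tangent_space M p; norm (p - p0) < r p0; norm w = 1; 0 < h; h < r p0\<rbrakk>
      \<Longrightarrow> \<exists>b\<in>M. norm (b - p - h *\<^sub>R w) \<le> \<epsilon> * h"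
    by metis
  have compact: "compact M" using M by (simp add: submanifold_def)
  obtain C where C: "C \<subseteq> M" "finite C" "M \<subseteq> (\<Union>p0\<in>C. ball p0 (r p0))"
  proof (rule compactE_image[OF compact, of M "\<lambda>p0. ball p0 (r p0)"])
    show "M \<subseteq> (\<Union>c\<in>M. ball c (r c))" using r(1) by force
  qed auto
  have "C \<noteq> {}" using C(3) M by (auto simp: submanifold_def)
  define \<rho> where "\<rho> = Min (r ` C)"
  have "\<rho> > 0" unfolding \<rho>_def using C r(1) \<open>C \<noteq> {}\<close> by auto
  moreover have "\<exists>b\<in>M. norm (b - p - h *\<^sub>R w) \<le> \<epsilon> * h"
    if a: "p \<in> M" "w \<in> tangent_space M p" "norm w = 1" "0 < h" "h < \<rho>" for p w h
  proof -
    obtain p0 where p0: "p0 \<in> C" "norm (p - p0) < r p0"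
      using C(3) a(1) by (auto simp: dist_norm norm_minus_commute)
    moreover have "\<rho> \<le> r p0" unfolding \<rho>_def using C p0 by simp
    ultimately show ?thesis using r(2)[of p0 p w h] a C by force
  qed
  ultimately show thesis using that by blast
qed

section \<open>Empty balls tangent to a submanifold\<close>

lemma subspace_tangent_space:
  assumes "submanifold d M" "p \<in> M"
  shows "subspace (tangent_space M p)"
  using submanifold_chart[OF assms] slice_chart.subspace_tangent_space assms(2) by metis

lemma normal_component_small:
  assumes M: "submanifold d M" and p: "p \<in> M"
    and n: "\<And>w. w \<in> tangent_space M p \<Longrightarrow> \<nu> \<bullet> w = 0" and e: "0 < \<epsilon>"
  shows "\<exists>r>0. \<forall>b\<in>M. norm (b - p) < r \<longrightarrow> \<nu> \<bullet> (b - p) \<le> \<epsilon> * norm (b - p)"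
proof -
  obtain U V S \<phi> \<psi> \<phi>' \<psi>' where "slice_chart M U V S \<phi> \<psi> \<phi>' \<psi>'" "p \<in> U"
    using submanifold_chart[OF M p] .
  then show ?thesis
    using slice_chart.normal_component_small[of M U V S \<phi> \<psi> \<phi>' \<psi>' p \<nu> \<epsilon>] p n e by simp
qed

text \<open>Every normal vector \<open>\<nu>\<close> at \<open>x\<close>, and not just the directions towards points whose nearest point is
  \<open>x\<close>, gives an empty ball. The nearest point \<open>p s\<close> of \<open>x + s *\<^sub>R \<nu>\<close> need not be \<open>x\<close>, but as \<open>M\<close> leaves
  \<open>x\<close> tangentially, \<open>p s - x\<close> is of smaller order than \<open>s\<close>. So the empty balls at \<open>p s\<close> converge to the
  one at \<open>x\<close> as \<open>s\<close> tends to \<open>0\<close>.\<close>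

lemma normal_ball_empty:
  assumes M: "submanifold d M" and t: "ereal t \<le> reach M" "0 < t"
    and x: "x \<in> M" and b: "b \<in> M" and n: "\<And>w. w \<in> tangent_space M x \<Longrightarrow> \<nu> \<bullet> w = 0"
  shows "2 * t * (\<nu> \<bullet> (b - x)) \<le> norm \<nu> * (norm (b - x))\<^sup>2"
proof -
  have cM: "compact M" "M \<noteq> {}" using M by (auto simp: submanifold_def)
  define p where "p s = closest_point M (x + s *\<^sub>R \<nu>)" for s
  define e where "e s = (1 / s) *\<^sub>R (p s - x)" for s
  have pM: "p s \<in> M" for s
    unfolding p_def using closest_point_in_set[OF compact_imp_closed[OF cM(1)] cM(2)] .
  have pnear: "norm (p s - (x + s *\<^sub>R \<nu>)) = infdist (x + s *\<^sub>R \<nu>) M" for s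
    unfolding p_def by (rule norm_closest_point[OF cM])
  have idist: "infdist (x + s *\<^sub>R \<nu>) M \<le> s * norm \<nu>" if "0 < s" for s
    using infdist_le[OF x, of "x + s *\<^sub>R \<nu>"] that by (simp add: dist_norm)
  have pe: "p s = x + s *\<^sub>R e s" if "0 < s" for s
    using that by (simp add: e_def)
  have e0: "(e \<longlongrightarrow> 0) (at_right 0)"
  proof (rule tendstoI)
    fix \<epsilon> :: real assume "0 < \<epsilon>"
    then have "0 < \<epsilon> / 4" by simp
    then obtain r where r: "r > 0"
      "\<And>c. c \<in> M \<Longrightarrow> norm (c - x) < r \<Longrightarrow> \<nu> \<bullet> (c - x) \<le> \<epsilon> / 4 * norm (c - x)"
      using normal_component_small[OF M x n] by blast
    have "dist (e s) 0 < \<epsilon>" if s: "0 < s" "2 * s * norm \<nu> < r" for s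
    proof -
      have le: "norm (p s - x - s *\<^sub>R \<nu>) \<le> s * norm \<nu>"
        using pnear[of s] idist[OF s(1)] by (simp add: diff_diff_eq)
      have "norm (p s - x) < r"
        using norm_triangle_ineq[of "p s - x - s *\<^sub>R \<nu>" "s *\<^sub>R \<nu>"] le s by simp
      then have small: "\<nu> \<bullet> (p s - x) \<le> \<epsilon> / 4 * norm (p s - x)" using r(2) pM by blast
      have "(norm (s *\<^sub>R \<nu> - (p s - x)))\<^sup>2 \<le> (s * norm \<nu>)\<^sup>2"
        using le s by (intro power_mono) (auto simp: norm_minus_commute)
      then have "(norm (p s - x))\<^sup>2 \<le> 2 * s * (\<nu> \<bullet> (p s - x))"
        unfolding norm_diff_scaleR_sq by (simp add: power_mult_distrib)
      also have "\<dots> \<le> 2 * s * (\<epsilon> / 4 * norm (p s - x))"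
        using small s by (intro mult_left_mono) auto
      finally have "norm (p s - x) * norm (p s - x) \<le> (s * \<epsilon> / 2) * norm (p s - x)"
        by (simp add: power2_eq_square mult_ac)
      then have "norm (p s - x) \<le> s * \<epsilon> / 2"
        using mult_right_le_imp_le[of "norm (p s - x)" "norm (p s - x)" "s * \<epsilon> / 2"] s \<open>0 < \<epsilon>\<close>
        by (cases "p s = x") simp_all
      moreover have "norm (e s) = norm (p s - x) / s" using s by (simp add: e_def)
      ultimately have "norm (e s) \<le> \<epsilon> / 2" using s by (simp add: divide_le_eq mult_ac)
      then show ?thesis using \<open>0 < \<epsilon>\<close> by simp
    qed
    moreover have "eventually (\<lambda>s. 2 * s * norm \<nu> < r) (at_right 0)"
      by (rule order_tendstoD(2)[of _ "2 * 0 * norm \<nu>"]) (use r in \<open>auto intro!: tendsto_eq_intros\<close>)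
    ultimately show "eventually (\<lambda>s. dist (e s) 0 < \<epsilon>) (at_right 0)"
      using eventually_at_right_less[of 0] by (auto elim: eventually_elim2)
  qed
  have "eventually (\<lambda>s. s * norm \<nu> < t) (at_right 0)"
    by (rule order_tendstoD(2)[of _ "0 * norm \<nu>"]) (use t in \<open>auto intro!: tendsto_eq_intros\<close>)
  then have ev: "eventually (\<lambda>s. 2 * t * ((\<nu> - e s) \<bullet> (b - (x + s *\<^sub>R e s))) \<le>
      norm (\<nu> - e s) * (norm (b - (x + s *\<^sub>R e s)))\<^sup>2) (at_right 0)"
    using eventually_at_right_less[of 0]
  proof eventually_elim
    case (elim s)
    have zp: "x + s *\<^sub>R \<nu> - p s = s *\<^sub>R (\<nu> - e s)"
      using pe elim by (simp add: algebra_simps)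
    have "2 * t * ((x + s *\<^sub>R \<nu> - p s) \<bullet> (b - p s)) \<le> norm (x + s *\<^sub>R \<nu> - p s) * (norm (b - p s))\<^sup>2"
    proof (cases "x + s *\<^sub>R \<nu> \<in> M")
      case True
      then have "p s = x + s *\<^sub>R \<nu>" by (simp add: p_def closest_point_self)
      then show ?thesis by simp
    next
      case False
      have "infdist (x + s *\<^sub>R \<nu>) M < t" using idist[of s] elim by simp
      then show ?thesis
        using empty_ball_of_nearest_point[OF cM t(1) False _ pM pnear b] by simp
    qed
    then have "s * (2 * t * ((\<nu> - e s) \<bullet> (b - p s))) \<le> s * (norm (\<nu> - e s) * (norm (b - p s))\<^sup>2)"
      unfolding zp using elim by (simp add: mult_ac)
    then show ?case using elim pe by simp
  qed
  have id0: "((\<lambda>s::real. s) \<longlongrightarrow> 0) (at_right 0)" by simp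
  have "((\<lambda>s. 2 * t * ((\<nu> - e s) \<bullet> (b - (x + s *\<^sub>R e s)))) \<longlongrightarrow>
      2 * t * ((\<nu> - 0) \<bullet> (b - (x + 0 *\<^sub>R 0)))) (at_right 0)"
    by (intro tendsto_intros e0)
  moreover have "((\<lambda>s. norm (\<nu> - e s) * (norm (b - (x + s *\<^sub>R e s)))\<^sup>2) \<longlongrightarrow>
      norm (\<nu> - 0) * (norm (b - (x + 0 *\<^sub>R 0)))\<^sup>2) (at_right 0)"
    by (intro tendsto_intros e0)
  ultimately show ?thesis
    using tendsto_le[OF _ _ _ ev] by simp
qed

text \<open>The empty ball in the direction of the normal part of \<open>b - x\<close>.\<close>

lemma tangent_infdist_le:
  assumes M: "submanifold d M" and t: "ereal t \<le> reach M" "0 < t" and x: "x \<in> M" and b: "b \<in> M"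
  shows "2 * t * infdist (b - x) (tangent_space M x) \<le> (norm (b - x))\<^sup>2"
proof -
  obtain a c where ac: "a \<in> tangent_space M x" "\<And>w. w \<in> tangent_space M x \<Longrightarrow> c \<bullet> w = 0" "b - x = a + c"
      "norm c \<le> norm (b - x)"
    using orthogonal_decomposition[OF subspace_tangent_space[OF M x], of "b - x"]
      by blast
  have "infdist (b - x) (tangent_space M x) \<le> norm c"
    using infdist_le[OF ac(1), of "b - x"] ac(3) by (simp add: dist_norm)
  moreover have "2 * t * norm c \<le> (norm (b - x))\<^sup>2"
  proof (cases "c = 0")
    case False
    have "c \<bullet> (b - x) = norm c * norm c"
      using ac by (simp add: inner_add_right power2_norm_eq_inner flip: power2_eq_square)
    then have "norm c * (2 * t * norm c) \<le> norm c * (norm (b - x))\<^sup>2"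
      using normal_ball_empty[OF M t x b ac(2)] by (simp add: mult_ac)
    then show ?thesis using False by simp
  qed simp
  moreover have "2 * t * infdist (b - x) (tangent_space M x) \<le> 2 * t * norm c"
    using calculation(1) t by (intro mult_left_mono) auto
  ultimately show ?thesis by linarith
qed

lemma reach_le_reach_estimator:
  assumes M: "submanifold d M" and t: "ereal t \<le> reach M" "0 < t" and X: "X \<subseteq> M"
  shows "ereal t \<le> reach_estimator M X"
  unfolding reach_estimator_def
proof (rule INF_greatest, clarify)
  fix x y assume xy: "x \<in> X" "y \<in> X" "x \<noteq> y"
  define D where "D = infdist (y - x) (tangent_space M x)"
  have "2 * t * D \<le> (norm (y - x))\<^sup>2"
    unfolding D_def using tangent_infdist_le[OF M t] xy X by blast
  moreover have "D \<ge> 0" by (simp add: D_def infdist_nonneg)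
  moreover have "(norm (y - x))\<^sup>2 > 0" using xy by simp
  ultimately show "ereal t \<le> ereal ((norm (y - x))\<^sup>2) / ereal (2 * infdist (y - x) (tangent_space M x))"
    unfolding D_def[symmetric]
    by (cases "D = 0") (simp_all add: field_simps)
qed

section \<open>Turning of the normal space along paths\<close>

text \<open>The vector \<open>n\<close> is normal at \<open>q\<close>, and \<open>a\<close> is its tangential part at the nearby point \<open>q'\<close>. Walking
  from \<open>q'\<close> in direction \<open>a\<close> by \<open>norm (q' - q)\<close> leads to a point \<open>b\<close> of \<open>M\<close> whose height over \<open>q\<close> in
  direction \<open>n\<close> grows in proportion to \<open>norm a\<close>. The balls at \<open>q\<close> and \<open>q'\<close> allow only a height quadratic
  in \<open>norm (q' - q)\<close>. The sign condition makes the step turn back, so that \<open>b\<close> is not too far from \<open>q\<close>.\<close>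

lemma tangential_part_le:
  assumes M: "submanifold d M" and t: "ereal t \<le> reach M" "0 < t" and q: "q \<in> M" "q' \<in> M"
    and n: "\<And>w. w \<in> tangent_space M q \<Longrightarrow> n \<bullet> w = 0" "norm n \<le> 1"
    and a: "a \<in> tangent_space M q'" "\<And>w. w \<in> tangent_space M q' \<Longrightarrow> (n - a) \<bullet> w = 0" "norm (n - a) \<le> 1"
    and sgn: "(q' - q) \<bullet> a \<le> 0"
    and step: "\<And>w. w \<in> tangent_space M q' \<Longrightarrow> norm w = 1 \<Longrightarrow>
        \<exists>b\<in>M. norm (b - q' - norm (q' - q) *\<^sub>R w) \<le> 1 / 16 * norm (q' - q)"
    and ne: "q \<noteq> q'"
  shows "t * norm a \<le> 5 / 2 * norm (q' - q)"
proof (cases "a = 0")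
  case False
  define k where "k = norm a"
  define h where "h = norm (q' - q)"
  define w where "w = (1 / k) *\<^sub>R a"
  have k: "k > 0" using False by (simp add: k_def)
  have h: "h > 0" using ne by (simp add: h_def)
  have w: "w \<in> tangent_space M q'" "norm w = 1" and aw: "a = k *\<^sub>R w"
    using a(1) k subspace_tangent_space[OF M q(2)] by (auto simp: w_def k_def subspace_scale)
  \<comment> \<open>A step as long as the distance from \<open>q\<close> to \<open>q'\<close> balances the linear gain in height against the
    quadratic errors.\<close>
  obtain b where b: "b \<in> M" "norm (b - q' - h *\<^sub>R w) \<le> 1 / 16 * h"
    using step[OF w] by (auto simp: h_def)
  define e where "e = b - q' - h *\<^sub>R w"
  have eh: "norm e \<le> h / 16" using b(2) by (simp add: e_def)
  have bq': "b - q' = h *\<^sub>R w + e" and bq: "b - q = (q' - q + h *\<^sub>R w) + e"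
    by (simp_all add: e_def)
  have n1: "norm (b - q') \<le> 17 / 16 * h"
    using norm_triangle_ineq[of "h *\<^sub>R w" e] eh w h unfolding bq' by simp
  have "(q' - q) \<bullet> w \<le> 0" using sgn k by (simp add: aw mult_le_0_iff)
  then have "h * ((q' - q) \<bullet> w) \<le> 0" using h by (simp add: mult_le_0_iff)
  moreover have "(norm (q' - q + h *\<^sub>R w))\<^sup>2 = h\<^sup>2 + 2 * (h * ((q' - q) \<bullet> w)) + h\<^sup>2"
    using norm_diff_scaleR_sq[of "-h" w "q' - q"] w(2)
    by (simp add: h_def norm_minus_commute inner_commute add.commute algebra_simps)
  ultimately have "(norm (q' - q + h *\<^sub>R w))\<^sup>2 \<le> 2 * h\<^sup>2" by linarith
  also have "\<dots> \<le> (3 / 2 * h)\<^sup>2" by (simp add: power2_eq_square)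
  finally have "norm (q' - q + h *\<^sub>R w) \<le> 3 / 2 * h"
    by (rule power2_le_imp_le) (use h in simp)
  then have "norm (b - q) \<le> 25 / 16 * h"
    using norm_triangle_ineq[of "q' - q + h *\<^sub>R w" e] eh unfolding bq by simp
  then have n2: "(norm (b - q))\<^sup>2 \<le> (25 / 16 * h)\<^sup>2"
    by (rule power_mono) simp
  have n3: "(norm (b - q'))\<^sup>2 \<le> (17 / 16 * h)\<^sup>2"
    using n1 by (rule power_mono) simp
  \<comment> \<open>Three empty balls: at \<open>q\<close> against \<open>b\<close>, at \<open>q\<close> against \<open>q'\<close>, and at \<open>q'\<close> against \<open>b\<close>.\<close>
  have i1: "2 * t * (n \<bullet> (b - q)) \<le> (norm (b - q))\<^sup>2"
    using normal_ball_empty[OF M t q(1) b(1) n(1)]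
      mult_right_mono[OF n(2), of "(norm (b - q))\<^sup>2"] by simp
  have i2: "2 * t * ((- n) \<bullet> (q' - q)) \<le> h\<^sup>2"
    using normal_ball_empty[OF M t q(1) q(2), of "- n"] n
      mult_right_mono[OF n(2), of "(norm (q' - q))\<^sup>2"] by (simp add: h_def)
  have i3: "2 * t * (- (n - a) \<bullet> (b - q')) \<le> (norm (b - q'))\<^sup>2"
    using normal_ball_empty[OF M t q(2) b(1), of "- (n - a)"] a
      mult_right_mono[OF a(3), of "(norm (b - q'))\<^sup>2"]
    by (simp add: norm_minus_commute inner_diff_left)
  have "w \<bullet> e \<ge> - (h / 16)"
    using Cauchy_Schwarz_ineq2[of w e] w eh by simp
  then have "k * (h + w \<bullet> e) \<ge> k * (15 / 16 * h)"
    using k by (intro mult_left_mono) auto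
  then have "15 / 16 * h * k \<le> a \<bullet> (b - q')"
    using w by (simp add: bq' aw inner_add_right norm_eq_1 algebra_simps)
  then have "2 * t * (15 / 16 * h * k) \<le> 2 * t * (a \<bullet> (b - q'))"
    using t by (intro mult_left_mono) auto
  also have "a \<bullet> (b - q') = n \<bullet> (b - q) + (- n) \<bullet> (q' - q) + (- (n - a) \<bullet> (b - q'))"
    by (simp add: algebra_simps)
  also have "2 * t * \<dots> \<le> (25 / 16 * h)\<^sup>2 + h\<^sup>2 + (17 / 16 * h)\<^sup>2"
    unfolding distrib_left using i1 i2 i3 n2 n3 by linarith
  also have "\<dots> \<le> 75 / 16 * h\<^sup>2" by (simp add: power_mult_distrib power_divide)
  finally have "2 * t * (15 / 16 * h * k) \<le> 75 / 16 * h\<^sup>2" .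
  then have "h * (t * k) \<le> h * (5 / 2 * h)" by (simp add: power2_eq_square mult_ac)
  then show ?thesis using h by (simp add: h_def k_def)
qed simp

text \<open>A local Lipschitz estimate for the tangent spaces, uniform over \<open>M\<close>. The sign condition
  of \<open>tangential_part_le\<close> is met after replacing \<open>n\<close> by \<open>- n\<close> if necessary.\<close>

lemma normal_tilt:
  assumes M: "submanifold d M" and t: "ereal t \<le> reach M" "0 < t"
  obtains \<rho> where "0 < \<rho>"
    "\<And>q q' n w. q \<in> M \<Longrightarrow> q' \<in> M \<Longrightarrow> norm (q' - q) < \<rho> \<Longrightarrow>
      (\<And>v. v \<in> tangent_space M q \<Longrightarrow> n \<bullet> v = 0) \<Longrightarrow> norm n \<le> 1 \<Longrightarrow> w \<in> tangent_space M q' \<Longrightarrow>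
      t * (n \<bullet> w) \<le> 5 / 2 * norm (q' - q) * norm w"
proof -
  obtain \<rho> where r: "0 < \<rho>"
    "\<And>p w h. p \<in> M \<Longrightarrow> w \<in> tangent_space M p \<Longrightarrow> norm w = 1 \<Longrightarrow> 0 < h \<Longrightarrow> h < \<rho>
      \<Longrightarrow> \<exists>b\<in>M. norm (b - p - h *\<^sub>R w) \<le> 1 / 16 * h"
    using uniform_tangential_step[OF M, of "1 / 16"] by auto
  have "t * (n \<bullet> w) \<le> 5 / 2 * norm (q' - q) * norm w"
    if q: "q \<in> M" "q' \<in> M" "norm (q' - q) < \<rho>"
      and n: "\<And>v. v \<in> tangent_space M q \<Longrightarrow> n \<bullet> v = 0" "norm n \<le> 1"
      and w: "w \<in> tangent_space M q'" for q q' n w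
  proof (cases "q = q'")
    case False
    then have step: "\<And>w. w \<in> tangent_space M q' \<Longrightarrow> norm w = 1 \<Longrightarrow>
        \<exists>b\<in>M. norm (b - q' - norm (q' - q) *\<^sub>R w) \<le> 1 / 16 * norm (q' - q)"
      using r(2)[OF q(2)] q(3) by simp
    have T: "subspace (tangent_space M q')" by (rule subspace_tangent_space[OF M q(2)])
    obtain a c where ac: "a \<in> tangent_space M q'" "\<And>w. w \<in> tangent_space M q' \<Longrightarrow> c \<bullet> w = 0"
        "n = a + c" "norm c \<le> norm n"
      using orthogonal_decomposition[OF T, of n]
      by blast
    have ta: "t * norm a \<le> 5 / 2 * norm (q' - q)"
    proof (cases "(q' - q) \<bullet> a \<le> 0")
      case True
      show ?thesis
        by (rule tangential_part_le[OF M t q(1,2) n ac(1) _ _ True step False]) (use ac n in auto)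
    next
      case neg: False
      have "t * norm (- a) \<le> 5 / 2 * norm (q' - q)"
      proof (rule tangential_part_le[OF M t q(1,2), of "- n" "- a"])
        show "- a \<in> tangent_space M q'" using ac(1) T by (simp add: subspace_neg)
        have "- n - - a = - c" using ac(3) by simp
        then show "\<And>w. w \<in> tangent_space M q' \<Longrightarrow> (- n - - a) \<bullet> w = 0" "norm (- n - - a) \<le> 1"
          using ac n by auto
      qed (use n neg step False in auto)
      then show ?thesis by simp
    qed
    have "n \<bullet> w \<le> norm a * norm w"
      using ac w norm_cauchy_schwarz[of a w] by (simp add: inner_add_left)
    then have "t * (n \<bullet> w) \<le> t * (norm a * norm w)"
      using t by (intro mult_left_mono) auto
    also have "\<dots> \<le> 5 / 2 * norm (q' - q) * norm w"
      using mult_right_mono[OF ta, of "norm w"] by (simp add: mult_ac)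
    finally show ?thesis .
  qed (use n w in simp)
  then show thesis using that r(1) by blast
qed

text \<open>The local estimates add up along a fine subdivision of the path: at each vertex the vector \<open>n\<close> is
  split into its tangential part, already controlled, and its normal part, to which
  \<open>normal_tilt\<close> applies.\<close>

lemma normal_tilt_along_path:
  assumes M: "submanifold d M" and t: "ereal t \<le> reach M" "0 < t"
    and \<gamma>: "path \<gamma>" "path_image \<gamma> \<subseteq> M" "pathstart \<gamma> = q" "pathfinish \<gamma> = x"
    and n: "\<And>v. v \<in> tangent_space M q \<Longrightarrow> n \<bullet> v = 0" "norm n \<le> 1"
    and w: "w \<in> tangent_space M x"
  shows "ereal (2 * t / 5 * (n \<bullet> w)) \<le> curve_length \<gamma> * ereal (norm w)"
proof -
  obtain \<rho> where rpos: "0 < \<rho>" and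
    tilt: "\<And>q q' n w. q \<in> M \<Longrightarrow> q' \<in> M \<Longrightarrow> norm (q' - q) < \<rho> \<Longrightarrow>
      (\<And>v. v \<in> tangent_space M q \<Longrightarrow> n \<bullet> v = 0) \<Longrightarrow> norm n \<le> 1 \<Longrightarrow> w \<in> tangent_space M q' \<Longrightarrow>
      t * (n \<bullet> w) \<le> 5 / 2 * norm (q' - q) * norm w"
    using normal_tilt[OF M t] by metis
  have "uniformly_continuous_on {0..1} \<gamma>"
    using \<gamma>(1) by (simp add: path_def compact_uniformly_continuous)
  then obtain \<delta> where \<delta>: "\<delta> > 0"
    "\<And>u v. u \<in> {0..1} \<Longrightarrow> v \<in> {0..1} \<Longrightarrow> dist v u < \<delta> \<Longrightarrow> dist (\<gamma> v) (\<gamma> u) < \<rho>"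
    unfolding uniformly_continuous_on_def using rpos by blast
  obtain N :: nat where N: "N > 0" "1 / real N < \<delta>"
    using \<delta>(1) by (metis nat_approx_posE zero_less_Suc)
  define g where "g k = \<gamma> (real k / real N)" for k
  have I: "real k / real N \<in> {0..1}" if "k \<le> N" for k using that N by simp
  have gM: "g k \<in> M" if "k \<le> N" for k
    using I[OF that] \<gamma>(2) by (auto simp: g_def path_image_def)
  have gstep: "norm (g (Suc k) - g k) < \<rho>" if "Suc k \<le> N" for k
  proof -
    have "dist (real (Suc k) / real N) (real k / real N) = 1 / real N"
      by (simp add: dist_real_def add_divide_distrib)
    then show ?thesis
      using \<delta>(2)[OF I[of k] I[OF that]] N that by (simp add: g_def dist_norm)
  qed
  have chain: "\<forall>w\<in>tangent_space M (g k). t * (n \<bullet> w) \<le> 5 / 2 * (\<Sum>i<k. norm (g (Suc i) - g i)) * norm w"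
    if "k \<le> N" for k
    using that
  proof (induction k)
    case 0
    have "g 0 = q" using \<gamma>(3) by (simp add: g_def pathstart_def)
    then show ?case using n by simp
  next
    case (Suc k)
    define L where "L = (\<Sum>i<k. norm (g (Suc i) - g i))"
    obtain a c where ac: "a \<in> tangent_space M (g k)" "\<And>w. w \<in> tangent_space M (g k) \<Longrightarrow> c \<bullet> w = 0"
        "n = a + c" "norm c \<le> norm n"
      using orthogonal_decomposition[OF subspace_tangent_space[OF M gM[OF Suc_leD[OF Suc.prems]]], of n]
      by blast
    have na: "n \<bullet> a = norm a * norm a"
      using ac by (simp add: inner_add_left power2_norm_eq_inner flip: power2_eq_square)
    have "t * (n \<bullet> a) \<le> 5 / 2 * L * norm a"
      using Suc ac(1) by (simp add: L_def)
    then have "norm a * (t * norm a) \<le> norm a * (5 / 2 * L)"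
      unfolding na by (simp add: mult_ac)
    moreover have "L \<ge> 0" by (simp add: L_def sum_nonneg)
    ultimately have ta: "t * norm a \<le> 5 / 2 * L" by (cases "a = 0") simp_all
    show ?case
    proof
      fix w assume w: "w \<in> tangent_space M (g (Suc k))"
      have "t * (a \<bullet> w) \<le> t * (norm a * norm w)"
        using t norm_cauchy_schwarz[of a w] by (intro mult_left_mono) auto
      also have "\<dots> \<le> 5 / 2 * L * norm w"
        using mult_right_mono[OF ta, of "norm w"] by (simp add: mult_ac)
      finally have "t * (a \<bullet> w) \<le> 5 / 2 * L * norm w" .
      moreover have "t * (c \<bullet> w) \<le> 5 / 2 * norm (g (Suc k) - g k) * norm w"
        by (rule tilt[OF gM gM gstep _ _ w]) (use Suc.prems ac n in auto)
      ultimately show "t * (n \<bullet> w) \<le> 5 / 2 * (\<Sum>i<Suc k. norm (g (Suc i) - g i)) * norm w"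
        unfolding sum.lessThan_Suc L_def[symmetric] ac(3) by (simp add: algebra_simps)
    qed
  qed
  define ts where "ts = map (\<lambda>k. real k / real N) [0..<Suc N]"
  have nth: "ts ! k = real k / real N" if "k \<le> N" for k
    unfolding ts_def using that by (subst nth_map) (auto simp del: upt_Suc)
  have len: "length ts = Suc N" by (simp add: ts_def)
  have "sorted ts" unfolding sorted_iff_nth_mono len using nth N by (auto intro: divide_right_mono)
  moreover have "set ts \<subseteq> {0..1}" unfolding ts_def using I by auto
  ultimately have "ereal (\<Sum>i<length ts - 1. norm (\<gamma> (ts ! Suc i) - \<gamma> (ts ! i))) \<le> curve_length \<gamma>"
    unfolding curve_length_def by (intro SUP_upper) simp
  also have "(\<Sum>i<length ts - 1. norm (\<gamma> (ts ! Suc i) - \<gamma> (ts ! i))) = (\<Sum>i<N. norm (g (Suc i) - g i))"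
    unfolding len by (intro sum.cong) (auto simp: g_def nth)
  finally have len_le: "ereal (\<Sum>i<N. norm (g (Suc i) - g i)) \<le> curve_length \<gamma>" .
  have "g N = x" using \<gamma>(4) N by (simp add: g_def pathfinish_def)
  then have "t * (n \<bullet> w) \<le> 5 / 2 * (\<Sum>i<N. norm (g (Suc i) - g i)) * norm w"
    using chain[of N] w by simp
  then have "ereal (2 * t / 5 * (n \<bullet> w)) \<le> ereal (\<Sum>i<N. norm (g (Suc i) - g i)) * ereal (norm w)"
    by simp
  also have "\<dots> \<le> curve_length \<gamma> * ereal (norm w)"
    using len_le by (intro ereal_mult_right_mono) auto
  finally show ?thesis .
qed

lemma norm_le_geodesic_dist: "ereal (norm (q - x)) \<le> geodesic_dist M q x"
  unfolding geodesic_dist_def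
proof (rule INF_greatest, clarify)
  fix \<gamma> :: "real \<Rightarrow> 'a"
  have "ereal (\<Sum>i<length [0, 1 :: real] - 1. norm (\<gamma> ([0, 1] ! Suc i) - \<gamma> ([0, 1] ! i))) \<le> curve_length \<gamma>"
    unfolding curve_length_def by (rule SUP_upper) auto
  then show "ereal (norm (pathstart \<gamma> - pathfinish \<gamma>)) \<le> curve_length \<gamma>"
    by (simp add: pathstart_def pathfinish_def norm_minus_commute)
qed

lemma normal_tilt_geodesic:
  assumes M: "submanifold d M" and t: "ereal t \<le> reach M" "0 < t"
    and m: "geodesic_dist M q x \<le> ereal m"
    and n: "\<And>v. v \<in> tangent_space M q \<Longrightarrow> n \<bullet> v = 0" "norm n \<le> 1"
    and x: "x \<in> M" and w: "w \<in> tangent_space M x"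
  shows "t * (n \<bullet> w) \<le> 5 / 2 * m * norm w"
proof (cases "w = 0")
  case False
  define w' where "w' = (1 / norm w) *\<^sub>R w"
  have w': "w' \<in> tangent_space M x" "norm w' = 1" "w = norm w *\<^sub>R w'"
    using False w subspace_tangent_space[OF M x] by (auto simp: w'_def subspace_scale)
  have "ereal (2 * t / 5 * (n \<bullet> w')) \<le> geodesic_dist M q x"
    unfolding geodesic_dist_def
  proof (rule INF_greatest, clarify)
    fix \<gamma> assume g: "path \<gamma>" "path_image \<gamma> \<subseteq> M" "q = pathstart \<gamma>" "x = pathfinish \<gamma>"
    show "ereal (2 * t / 5 * (n \<bullet> w')) \<le> curve_length \<gamma>"
      using normal_tilt_along_path[OF M t g(1,2) g(3)[symmetric] g(4)[symmetric] n w'(1)] w'(2)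
      by (simp add: one_ereal_def[symmetric])
  qed
  then have "2 * t / 5 * (n \<bullet> w') \<le> m" using m by (metis ereal_less_eq(3) order_trans)
  then have "norm w * (t * (n \<bullet> w')) \<le> norm w * (5 / 2 * m)"
    by (intro mult_left_mono) auto
  then show ?thesis by (subst w'(3)) (simp add: mult_ac)
qed simp

section \<open>Submanifolds with a bottleneck\<close>

text \<open>Along a curve in \<open>M\<close> through \<open>p\<close>, the squared distance to \<open>z\<close> is minimal at \<open>p\<close>.\<close>

lemma nearest_point_normal:
  assumes p: "p \<in> M" "\<And>b. b \<in> M \<Longrightarrow> norm (p - z) \<le> norm (b - z)" and v: "v \<in> tangent_space M p"
  shows "(p - z) \<bullet> v = 0"
proof -
  obtain \<gamma> \<epsilon> where e: "0 < \<epsilon>" and im: "\<gamma> ` {-\<epsilon><..<\<epsilon>} \<subseteq> M" and g0: "\<gamma> 0 = p"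
    and dg: "(\<gamma> has_vector_derivative v) (at 0)"
    using v unfolding tangent_space_def by blast
  define f where "f h = (\<gamma> h - z) \<bullet> (\<gamma> h - z)" for h
  have "(f has_derivative (\<lambda>h. 2 * ((p - z) \<bullet> v) * h)) (at 0)"
    unfolding f_def
    by (rule derivative_eq_intros dg[unfolded has_vector_derivative_def] refl)+
      (simp add: g0 inner_commute fun_eq_iff)
  then have "DERIV f 0 :> 2 * ((p - z) \<bullet> v)"
    by (simp add: has_field_derivative_def)
  moreover have "\<forall>y. \<bar>0 - y\<bar> < \<epsilon> \<longrightarrow> f 0 \<le> f y"
  proof (intro allI impI)
    fix y assume "\<bar>0 - y\<bar> < \<epsilon>"
    then have "y \<in> {-\<epsilon><..<\<epsilon>}" by auto
    then have "\<gamma> y \<in> M" using im by blast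
    then show "f 0 \<le> f y"
      using p(2) by (simp add: f_def g0 flip: power2_norm_eq_inner)
  qed
  ultimately have "2 * ((p - z) \<bullet> v) = 0" using DERIV_local_min e by blast
  then show ?thesis by simp
qed

text \<open>The centre \<open>z\<close> is at distance at least \<open>t\<close> from \<open>M\<close>, so both \<open>q1\<close> and \<open>q2\<close> are nearest to it. As they
  are \<open>2 * t\<close> apart, \<open>z\<close> is their midpoint and the segment between them is normal to \<open>M\<close> at both ends.\<close>

lemma bottleneck_normal:
  assumes "bottleneck M q1 q2" and t: "reach M = ereal t"
  shows "norm (q2 - q1) = 2 * t"
    and "\<And>v. v \<in> tangent_space M q1 \<Longrightarrow> (q2 - q1) \<bullet> v = 0"
    and "\<And>v. v \<in> tangent_space M q2 \<Longrightarrow> (q2 - q1) \<bullet> v = 0"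
proof -
  obtain z where q: "q1 \<in> M" "q2 \<in> M" and z: "z \<in> medial_axis M"
    "norm (q1 - z) \<le> t" "norm (q2 - z) \<le> t" and d: "norm (q1 - q2) = 2 * t"
    using assms unfolding bottleneck_def by auto
  have far: "t \<le> norm (b - z)" if "b \<in> M" for b
  proof -
    have "ereal t \<le> ereal (infdist z M)"
      unfolding t[symmetric] reach_def using z(1) by (rule INF_lower)
    then show ?thesis
      using infdist_le[OF that, of z] by (simp add: dist_norm norm_minus_commute)
  qed
  have sq: "(norm (q1 - z))\<^sup>2 \<le> t\<^sup>2" "(norm (q2 - z))\<^sup>2 \<le> t\<^sup>2"
    using z(2,3) by (auto intro!: power_mono)
  have "(norm ((q1 - z) + (q2 - z)))\<^sup>2 =
      2 * (norm (q1 - z))\<^sup>2 + 2 * (norm (q2 - z))\<^sup>2 - (norm (q1 - q2))\<^sup>2"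
    by (simp add: power2_norm_eq_inner algebra_simps inner_commute)
  also have "\<dots> \<le> 0" using sq d by (simp add: power_mult_distrib)
  finally have "(q1 - z) + (q2 - z) = 0" by simp
  then have mid: "q2 - q1 = (-2) *\<^sub>R (q1 - z)" "q2 - q1 = 2 *\<^sub>R (q2 - z)"
    by (simp_all add: algebra_simps scaleR_2 eq_neg_iff_add_eq_0 add_eq_0_iff)
  show "norm (q2 - q1) = 2 * t" using d by (simp add: norm_minus_commute)
  show "(q2 - q1) \<bullet> v = 0" if "v \<in> tangent_space M q1" for v
    using nearest_point_normal[OF q(1) _ that, of z] far z(2) order_trans unfolding mid(1) by fastforce
  show "(q2 - q1) \<bullet> v = 0" if "v \<in> tangent_space M q2" for v
    using nearest_point_normal[OF q(2) _ that, of z] far z(3) order_trans unfolding mid(2) by fastforce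
qed

text \<open>Here \<open>W\<close> is the squared length of a chord and \<open>D\<close> its distance to a tangent space. The errors in the
  hypotheses are quadratic in \<open>m\<close>, whereas the conclusion allows a loss that is linear in \<open>m\<close>.\<close>

lemma distance_bound_arithmetic:
  fixes t m D W :: real
  assumes t: "0 < t" and m: "0 \<le> m" "4 * m \<le> t" and D: "0 \<le> D" "W - (7 * m)\<^sup>2 \<le> D\<^sup>2"
    and W: "4 * t\<^sup>2 - 4 * m\<^sup>2 \<le> W" "W \<le> 4 * t\<^sup>2 + 8 * m\<^sup>2"
  shows "(t - 4 * m) * W \<le> 2 * t\<^sup>2 * D"
proof (rule power2_le_imp_le)
  have mt: "m * m \<le> m * t" "m * m \<le> t * t / 16" "m * t \<le> t * t / 4"
    using m t mult_mono[of "4 * m" t "4 * m" t] mult_left_mono[of m t m] mult_right_mono[of "4 * m" t t] by auto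
  have W0: "0 \<le> W" using W(1) mt zero_le_square[of t] unfolding power2_eq_square by linarith
  have "(t - 4 * m) * W \<le> (t - 4 * m) * (4 * t\<^sup>2 + 8 * m\<^sup>2)"
    using W m by (intro mult_left_mono) auto
  also have "\<dots> = 4 * t ^ 3 - 8 * m * (2 * (t * t) - m * t + 4 * (m * m))"
    by (simp add: power2_eq_square power3_eq_cube algebra_simps)
  also have "\<dots> \<le> 4 * t ^ 3"
  proof -
    have "0 \<le> 2 * (t * t) - m * t + 4 * (m * m)"
      using mt zero_le_square[of t] zero_le_square[of m] by linarith
    then show ?thesis using m by simp
  qed
  finally have up: "(t - 4 * m) * W \<le> 4 * t ^ 3" .
  \<comment> \<open>One factor of the square is bounded by \<open>up\<close>, which leaves an inequality linear in \<open>W\<close>.\<close>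
  have "49 * (m * t) \<le> 4 * W" using W(1) mt by (simp add: power2_eq_square)
  then have "4 * (m * t ^ 3) * (49 * (m * t)) \<le> 4 * (m * t ^ 3) * (4 * W)"
    using m t by (intro mult_left_mono) auto
  then have "4 * t ^ 3 * ((t - 4 * m) * W) \<le> 4 * t ^ 4 * (W - (7 * m)\<^sup>2)"
    by (simp add: power2_eq_square power3_eq_cube power4_eq_xxxx algebra_simps)
  also have "\<dots> \<le> 4 * t ^ 4 * D\<^sup>2" using D t by (intro mult_left_mono) auto
  finally have "4 * t ^ 3 * ((t - 4 * m) * W) \<le> (2 * t\<^sup>2 * D)\<^sup>2"
    by (simp add: power_mult_distrib flip: power_mult)
  moreover have "((t - 4 * m) * W)\<^sup>2 \<le> 4 * t ^ 3 * ((t - 4 * m) * W)"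
    unfolding power2_eq_square using m W0 by (intro mult_right_mono up) auto
  ultimately show "((t - 4 * m) * W)\<^sup>2 \<le> (2 * t\<^sup>2 * D)\<^sup>2" by linarith
  show "0 \<le> 2 * t\<^sup>2 * D" using D by simp
qed

text \<open>The chord \<open>y - x\<close> differs from \<open>q2 - q1\<close> by a vector \<open>e\<close> of norm at most \<open>2 * m\<close>. By the empty balls at
  \<open>q1\<close> and \<open>q2\<close>, the component of \<open>e\<close> along \<open>q2 - q1\<close> is only quadratic in \<open>m\<close>. The projection of the
  chord to the tangent space at \<open>x\<close> is at most \<open>7 * m\<close>: \<open>2 * m\<close> comes from \<open>e\<close>, and \<open>5 * m\<close> from turning the
  tangent space at \<open>q1\<close>, where \<open>q2 - q1\<close> of norm \<open>2 * t\<close> is normal, into the one at \<open>x\<close>.\<close>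

lemma tangential_distance_near_bottleneck:
  assumes M: "submanifold d M" and t: "reach M = ereal t" "0 < t"
    and bn: "bottleneck M q1 q2" and xy: "x \<in> M" "y \<in> M"
    and m: "geodesic_dist M q1 x \<le> ereal m" "geodesic_dist M q2 y \<le> ereal m" "4 * m \<le> t"
  shows "(t - 4 * m) * (norm (y - x))\<^sup>2 \<le> 2 * t\<^sup>2 * infdist (y - x) (tangent_space M x)"
proof (rule distance_bound_arithmetic)
  note bn' = bottleneck_normal[OF bn t(1)]
  have tr: "ereal t \<le> reach M" by (simp add: t)
  have q: "q1 \<in> M" "q2 \<in> M" using bn by (auto simp: bottleneck_def)
  have a: "norm (x - q1) \<le> m" and b: "norm (y - q2) \<le> m"
    using order_trans[OF norm_le_geodesic_dist m(1)] order_trans[OF norm_le_geodesic_dist m(2)]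
    by (simp_all add: norm_minus_commute)
  then show m0: "0 \<le> m" using norm_ge_zero order_trans by blast
  have half: "\<bar>(q2 - q1) \<bullet> (b - q)\<bar> \<le> (norm (b - q))\<^sup>2"
    if "q \<in> M" "b \<in> M" and n: "\<And>v. v \<in> tangent_space M q \<Longrightarrow> (q2 - q1) \<bullet> v = 0" for q b
    using normal_ball_empty[OF M tr t(2) that(1,2) n] t(2)
      normal_ball_empty[OF M tr t(2) that(1,2), of "- (q2 - q1)"] n bn'(1)
    by (simp add: abs_le_iff norm_minus_commute inner_diff_left)
  have ab2: "(norm (x - q1))\<^sup>2 \<le> m\<^sup>2" "(norm (y - q2))\<^sup>2 \<le> m\<^sup>2"
    using a b by (auto intro!: power_mono)
  define e where "e = (y - q2) - (x - q1)"
  have v: "y - x = (q2 - q1) + e" by (simp add: e_def)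
  have e2: "norm e \<le> 2 * m"
    using norm_triangle_ineq4[of "y - q2" "x - q1"] a b by (simp add: e_def)
  then have e3: "(norm e)\<^sup>2 \<le> 4 * m\<^sup>2"
    using power_mono[OF e2, of 2] by (simp add: power_mult_distrib)
  have ue: "\<bar>(q2 - q1) \<bullet> e\<bar> \<le> 2 * m\<^sup>2"
    using half[OF q(1) xy(1) bn'(2)] half[OF q(2) xy(2) bn'(3)] ab2
    unfolding e_def inner_diff_right[of _ "y - q2"] by linarith
  have "(norm (y - x))\<^sup>2 = (norm (q2 - q1))\<^sup>2 + 2 * ((q2 - q1) \<bullet> e) + (norm e)\<^sup>2"
    unfolding v by (simp only: power2_norm_eq_inner inner_add_left inner_add_right inner_commute)
  then have W: "(norm (y - x))\<^sup>2 = 4 * t\<^sup>2 + 2 * ((q2 - q1) \<bullet> e) + (norm e)\<^sup>2"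
    unfolding bn'(1) by (simp add: power_mult_distrib)
  show "4 * t\<^sup>2 - 4 * m\<^sup>2 \<le> (norm (y - x))\<^sup>2" "(norm (y - x))\<^sup>2 \<le> 4 * t\<^sup>2 + 8 * m\<^sup>2"
    unfolding W using ue e3 zero_le_power2[of "norm e"] by linarith+
  have T: "subspace (tangent_space M x)" by (rule subspace_tangent_space[OF M xy(1)])
  show "(norm (y - x))\<^sup>2 - (7 * m)\<^sup>2 \<le> (infdist (y - x) (tangent_space M x))\<^sup>2"
  proof (rule infdist_ge_of_tangential_bound[OF T])
    fix w assume w: "w \<in> tangent_space M x"
    have "t * (((1 / (2 * t)) *\<^sub>R (q2 - q1)) \<bullet> w) \<le> 5 / 2 * m * norm w"
      by (rule normal_tilt_geodesic[OF M tr t(2) m(1) _ _ xy(1) w]) (use bn' t in auto)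
    then have "(q2 - q1) \<bullet> w \<le> 5 * m * norm w" using t(2) by simp
    moreover have "e \<bullet> w \<le> 2 * m * norm w"
      using norm_cauchy_schwarz[of e w] mult_right_mono[OF e2, of "norm w"] by simp
    ultimately show "(y - x) \<bullet> w \<le> 7 * m * norm w"
      unfolding v inner_add_left by simp
  qed
qed (use t m infdist_nonneg in auto)

theorem proposition4p2:
  fixes M X :: "'a::euclidean_space set" and d :: nat and q1 q2 x y :: 'a
  assumes "2 \<le> DIM('a)"
    and "submanifold d M"
    and "0 < reach M"
    and "bottleneck M q1 q2"
    and "X \<subseteq> M"
    and "x \<in> X" and "y \<in> X"
    and "ereal (norm (q1 - x)) < reach M" and "ereal (norm (q2 - y)) < reach M"
  shows "0 \<le> 1 / reach M - 1 / reach_estimator M X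
    \<and> 1 / reach M - 1 / reach_estimator M X \<le> 1 / reach M - 1 / reach_estimator M {x, y}
    \<and> 1 / reach M - 1 / reach_estimator M {x, y}
        \<le> 4 / (reach M)\<^sup>2 * max (geodesic_dist M q1 x) (geodesic_dist M q2 y)"
proof -
  note M = \<open>submanifold d M\<close> and bn = \<open>bottleneck M q1 q2\<close>
  obtain t where t: "reach M = ereal t" "0 < t"
    using bn \<open>0 < reach M\<close> unfolding bottleneck_def by (cases "reach M") auto
  have tr: "ereal t \<le> reach M" by (simp add: t)
  have xyM: "x \<in> M" "y \<in> M" using assms by auto
  have "x \<noteq> y"
    using norm_triangle_ineq4[of "q1 - x" "q2 - x"] bottleneck_normal(1)[OF bn t(1)] assms(8,9)
    by (auto simp: t norm_minus_commute)
  define E where "E = reach_estimator M {x, y}"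
  define G where "G = max (geodesic_dist M q1 x) (geodesic_dist M q2 y)"
  have tX: "ereal t \<le> reach_estimator M X"
    by (rule reach_le_reach_estimator[OF M tr t(2) \<open>X \<subseteq> M\<close>])
  have tE: "ereal t \<le> E"
    unfolding E_def by (rule reach_le_reach_estimator[OF M tr t(2)]) (use xyM in simp)
  have XE: "reach_estimator M X \<le> E"
    unfolding E_def reach_estimator_def by (rule INF_superset_mono) (use assms in auto)
  have recip: "0 \<le> 1 / F \<and> 1 / F \<le> ereal (1 / t)" if "ereal t \<le> F" for F
    using that t(2) by (cases F) (auto simp: one_ereal_def field_simps)
  have recip_mono: "1 / F' \<le> 1 / F" if "ereal t \<le> F" "F \<le> F'" for F F'
    using that t(2) by (cases F; cases F') (auto simp: one_ereal_def field_simps)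
  have rt: "1 / reach M = ereal (1 / t)" using t by (simp add: one_ereal_def)
  have one: "0 \<le> 1 / reach M - 1 / reach_estimator M X"
    using recip[OF tX] unfolding rt by (cases "1 / reach_estimator M X") auto
  have "1 / E \<le> 1 / reach_estimator M X"
    by (rule recip_mono[OF tX XE])
  then have two: "1 / reach M - 1 / reach_estimator M X \<le> 1 / reach M - 1 / E"
    by (intro ereal_minus_mono) auto
  have three: "1 / reach M - 1 / E \<le> 4 / (reach M)\<^sup>2 * G"
  proof (cases G)
    case (real m)
    then have m: "geodesic_dist M q1 x \<le> ereal m" "geodesic_dist M q2 y \<le> ereal m"
      using max.cobounded1 max.cobounded2 unfolding G_def by metis+
    have rhs: "4 / (reach M)\<^sup>2 * G = ereal (4 * m / t\<^sup>2)"
      using t real by (simp add: power2_eq_square)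
    show ?thesis
    proof (cases "4 * m \<le> t")
      case False
      then have "1 / t \<le> 4 * m / t\<^sup>2" using t(2) by (simp add: field_simps power2_eq_square)
      then show ?thesis
        using recip[OF tE] unfolding rt rhs by (cases "1 / E") auto
    next
      case True
      define W where "W = (norm (y - x))\<^sup>2"
      define D where "D = infdist (y - x) (tangent_space M x)"
      have W: "W > 0" using \<open>x \<noteq> y\<close> by (simp add: W_def)
      have D0: "D \<ge> 0" by (simp add: D_def infdist_nonneg)
      have key: "(t - 4 * m) * W \<le> 2 * t\<^sup>2 * D"
        unfolding W_def D_def by (rule tangential_distance_near_bottleneck[OF M t bn xyM m True])
      have "E \<le> ereal W / ereal (2 * D)"
        unfolding E_def reach_estimator_def W_def D_def
        by (rule INF_lower2[of "(x, y)"]) (use \<open>x \<noteq> y\<close> in auto)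
      have "ereal (2 * D / W) \<le> 1 / E"
      proof (cases "D = 0")
        case True
        then show ?thesis using recip[OF tE] by (simp flip: zero_ereal_def)
      next
        case False
        have "1 / (ereal W / ereal (2 * D)) \<le> 1 / E"
          by (rule recip_mono[OF tE \<open>E \<le> ereal W / ereal (2 * D)\<close>])
        then show ?thesis using False W D0 by (simp add: one_ereal_def)
      qed
      moreover have "1 / t - 2 * D / W \<le> 4 * m / t\<^sup>2"
      proof -
        have "(t - 4 * m) / t\<^sup>2 \<le> 2 * D / W"
          using key t(2) W by (simp add: field_simps)
        moreover have "(t - 4 * m) / t\<^sup>2 = 1 / t - 4 * m / t\<^sup>2"
          using t(2) by (simp add: power2_eq_square diff_divide_distrib)
        ultimately show ?thesis by simp
      qed
      ultimately show ?thesis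
        using recip[OF tE] unfolding rt rhs by (cases "1 / E") auto
    qed
  next
    case PInf
    then show ?thesis using t by (simp add: power2_eq_square)
  next
    case MInf
    have "0 \<le> G"
      using order_trans[OF _ norm_le_geodesic_dist[of q1 x M], of 0] by (simp add: G_def le_max_iff_disj)
    then show ?thesis using MInf by simp
  qed
  show ?thesis using one two three unfolding E_def G_def by blast
qed

end
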